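(* Let $\eta>0$, $\vartheta_1>0$, $\beta_1=\frac32+\eta$, $r_1=1$, and put $m=1+\frac{3}{2\eta}$. For $(r,\beta,\vartheta)$ with $\beta,\vartheta>0$, consider the compatibility conditions with the model $(r_1,\beta_1,\vartheta_1)$, $$\vartheta\Big(\beta-\frac{3}{2r}\Big)^{1/r}=\vartheta_1\eta,\qquad \vartheta\,\frac{\Gamma(\beta+\frac1r)}{\Gamma(\beta)}=\vartheta_1\Big(\eta+\frac32\Big).$$ (i) If $r=\frac12$ and $(\beta,\vartheta)=(\beta_2,\vartheta_2)$, with $\beta_2>3$, satisfies these conditions, then $$\beta_2=\frac{6m+1+\sqrt{48m+1}}{2(m-1)},\qquad \vartheta_2=\vartheta_1\frac{\eta}{(\beta_2-3)^2}.$$ (ii) If $r=-\frac12$ and $(\beta,\vartheta)=(\beta_3,\vartheta_3)$, with $\beta_3>2$, satisfies these conditions, then, for one of the choices of sign, $$\beta_3=\frac{6+3m\pm\sqrt{m^2+80m}}{2(m-1)},\qquad \vartheta_3=\vartheta_1\eta(\beta_3+3)^2.$$ (iii) If $r=-1$ and $(\beta,\vartheta)=(\beta_4,\vartheta_4)$, with $\beta_4>1$, satisfies these conditions, then $$\beta_4=1+\frac53\eta,\qquad \vartheta_4=\vartheta_1\eta\Big(\beta_4+\frac32\Big).$$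
   Context: $\Gamma$ is the Euler gamma function. The parameters $(r,\beta,\vartheta)$ are those of the generalized gamma distribution on $(0,\infty)$ with density $\frac{|r|}{\Gamma(\beta)\vartheta}\left(\frac{\theta}{\vartheta}\right)^{r\beta-1}\exp\left(-(\theta/\vartheta)^r\right)$. The first condition matches the baseline values $\vartheta(\beta-\frac{3}{2r})^{1/r}$ of the variance, which require $\beta-\frac{3}{2r}>0$; the second matches the means $\vartheta\,\Gamma(\beta+\frac1r)/\Gamma(\beta)$, which are assumed finite, i.e. $\beta+\frac1r>0$. *)

theory Defs
  imports "HOL-Analysis.Analysis"
begin

text \<open>
  Generalized gamma distribution on the positive half-line with density
  \<open>\<bar>r\<bar> / (Gamma \<beta> * \<theta>) * (x / \<theta>) powr (r * \<beta> - 1) * exp (- ((x / \<theta>) powr r))\<close>;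
  the scale is written \<open>\<theta>\<close>.
  The baseline is meaningful only for \<open>\<beta> - 3 / (2 * r) > 0\<close> (\<open>powr\<close> is the usual real power
  only for a positive base), the mean is finite only for \<open>\<beta> + 1 / r > 0\<close>.
\<close>

definition gg_baseline :: "real \<Rightarrow> real \<Rightarrow> real \<Rightarrow> real" where
  "gg_baseline r \<beta> \<theta> = \<theta> * (\<beta> - 3 / (2 * r)) powr (1 / r)"

definition gg_mean :: "real \<Rightarrow> real \<Rightarrow> real \<Rightarrow> real" where
  "gg_mean r \<beta> \<theta> = \<theta> * (Gamma (\<beta> + 1 / r) / Gamma \<beta>)"

definition compatible :: "real \<Rightarrow> real \<Rightarrow> real \<Rightarrow> real \<Rightarrow> real \<Rightarrow> bool" where
  "compatible \<eta> \<theta>\<^sub>1 r \<beta> \<theta> \<longleftrightarrow>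
     \<beta> > 0 \<and> \<theta> > 0 \<and>
     gg_baseline r \<beta> \<theta> = \<theta>\<^sub>1 * \<eta> \<and>
     gg_mean r \<beta> \<theta> = \<theta>\<^sub>1 * (\<eta> + 3 / 2)"

text \<open>
  The right-hand sides are the baseline and the mean of the reference model
  \<open>r\<^sub>1 = 1\<close>, \<open>\<beta>\<^sub>1 = 3 / 2 + \<eta>\<close>.
\<close>

lemma gg_baseline_reference:
  assumes "\<eta> > 0"
  shows "gg_baseline 1 (3 / 2 + \<eta>) \<theta>\<^sub>1 = \<theta>\<^sub>1 * \<eta>"
  using assms by (simp add: gg_baseline_def)

lemma gg_mean_reference:
  assumes "\<eta> > 0"
  shows "gg_mean 1 (3 / 2 + \<eta>) \<theta>\<^sub>1 = \<theta>\<^sub>1 * (\<eta> + 3 / 2)"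
proof -
  define b where "b = 3 / 2 + \<eta>"
  have "b > 0" using assms by (simp add: b_def)
  then have "b \<notin> \<int>\<^sub>\<le>\<^sub>0" by (auto elim!: nonpos_Ints_cases)
  then have "Gamma (b + 1) = b * Gamma b" by (rule Gamma_plus1)
  moreover have "Gamma b > 0" using \<open>b > 0\<close> by (rule Gamma_real_pos)
  ultimately have "gg_mean 1 b \<theta>\<^sub>1 = \<theta>\<^sub>1 * b" by (simp add: gg_mean_def)
  then show ?thesis by (simp add: b_def add.commute)
qed

end

theory Submission
  imports Defs "HOL-Library.Quadratic_Discriminant"
begin

text \<open>
  Dividing the second compatibility condition by the first eliminates the scale and leaves
  one equation for the shape: the Gamma quotient equals
  \<open>m = (\<eta> + 3 / 2) / \<eta>\<close> times the power in the baseline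
  (\<open>compatible_imp_shape_equation\<close>). For the three values of \<open>r\<close> the number
  \<open>1 / r\<close> is one of the integers \<open>2\<close>, \<open>-2\<close>, \<open>-1\<close>, so the
  functional equation turns the Gamma quotient into a rational function of \<open>\<beta>\<close>, and the
  shape equation becomes
  \<open>\<beta> (\<beta> + 1) = m (\<beta> - 3)\<^sup>2\<close>, \<open>(\<beta> + 3)\<^sup>2 = m (\<beta> - 1) (\<beta> - 2)\<close> and
  \<open>\<beta> + 3 / 2 = m (\<beta> - 1)\<close> respectively. Two quadratics and one linear equation remain to be
  solved; the leading coefficient is \<open>m - 1 > 0\<close> each time. In the first quadratic the
  condition \<open>\<beta> > 3\<close> excludes the smaller root, because the quadratic takes the negative value
  \<open>-12\<close> at \<open>3\<close>. The scale is recovered from the baseline condition.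
\<close>

lemma Gamma_add_one_pos:
  fixes x :: real
  assumes "x > 0"
  shows "Gamma (x + 1) = x * Gamma x"
  using assms by (intro Gamma_plus1) (auto elim!: nonpos_Ints_cases)

lemma Gamma_add_two_pos:
  fixes x :: real
  assumes "x > 0"
  shows "Gamma (x + 2) = x * (x + 1) * Gamma x"
  using Gamma_add_one_pos[of x] Gamma_add_one_pos[of "x + 1"] assms
  by (simp add: algebra_simps)

lemma compatible_imp_shape_equation:
  assumes "\<eta> > 0" and "compatible \<eta> \<theta>\<^sub>1 r \<beta> \<theta>"
  shows "Gamma (\<beta> + 1 / r) / Gamma \<beta>
           = (1 + 3 / (2 * \<eta>)) * (\<beta> - 3 / (2 * r)) powr (1 / r)"
proof -
  let ?p = "(\<beta> - 3 / (2 * r)) powr (1 / r)"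
  have "\<theta> > 0" and base: "\<theta> * ?p = \<theta>\<^sub>1 * \<eta>"
    and mean: "\<theta> * (Gamma (\<beta> + 1 / r) / Gamma \<beta>) = \<theta>\<^sub>1 * (\<eta> + 3 / 2)"
    using assms(2) by (auto simp: compatible_def gg_baseline_def gg_mean_def)
  have "\<theta>\<^sub>1 * (\<eta> + 3 / 2) = (1 + 3 / (2 * \<eta>)) * (\<theta>\<^sub>1 * \<eta>)"
    using \<open>\<eta> > 0\<close> by (simp add: field_simps)
  then have "\<theta> * (Gamma (\<beta> + 1 / r) / Gamma \<beta>) = \<theta> * ((1 + 3 / (2 * \<eta>)) * ?p)"
    unfolding mean base[symmetric] by (simp only: mult_ac)
  with \<open>\<theta> > 0\<close> show ?thesis by (simp only: mult_cancel_left) simp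
qed

lemma shape_half:
  fixes \<beta> m :: real
  assumes "m > 1" and "\<beta> > 3" and eq: "\<beta> * (\<beta> + 1) = m * (\<beta> - 3)\<^sup>2"
  shows "\<beta> = (6 * m + 1 + sqrt (48 * m + 1)) / (2 * (m - 1))"
proof -
  have "(m - 1) * \<beta>\<^sup>2 + (- (6 * m + 1)) * \<beta> + 9 * m = 0"
    using eq by (simp add: power2_eq_square algebra_simps)
  moreover have "discrim (m - 1) (- (6 * m + 1)) (9 * m) = 48 * m + 1"
    by (simp add: discrim_def power2_eq_square algebra_simps)
  ultimately have roots: "\<beta> = (6 * m + 1 + sqrt (48 * m + 1)) / (2 * (m - 1)) \<or>
      \<beta> = (6 * m + 1 - sqrt (48 * m + 1)) / (2 * (m - 1))"
    using discriminant_iff[of "m - 1" \<beta> "- (6 * m + 1)" "9 * m"] \<open>m > 1\<close>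
    by (simp add: add.commute)
  \<comment> \<open>The bound \<open>7\<close> is what puts the smaller root below \<open>3\<close>:
    \<open>6 m + 1 - 7 = 3 * (2 * (m - 1))\<close>.\<close>
  have "sqrt (48 * m + 1) > 7"
    using \<open>m > 1\<close> by (intro real_less_rsqrt) simp
  then have "(6 * m + 1 - sqrt (48 * m + 1)) / (2 * (m - 1)) < 3"
    using \<open>m > 1\<close> by (simp add: divide_less_eq)
  with roots \<open>\<beta> > 3\<close> show ?thesis by linarith
qed

lemma shape_minus_half:
  fixes \<beta> m :: real
  assumes "m > 1" and eq: "(\<beta> + 3)\<^sup>2 = m * ((\<beta> - 1) * (\<beta> - 2))"
  shows "\<beta> = (6 + 3 * m + sqrt (m\<^sup>2 + 80 * m)) / (2 * (m - 1)) \<or>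
         \<beta> = (6 + 3 * m - sqrt (m\<^sup>2 + 80 * m)) / (2 * (m - 1))"
proof -
  have "(m - 1) * \<beta>\<^sup>2 + (- (6 + 3 * m)) * \<beta> + (2 * m - 9) = 0"
    using eq by (simp add: power2_eq_square algebra_simps)
  moreover have "discrim (m - 1) (- (6 + 3 * m)) (2 * m - 9) = m\<^sup>2 + 80 * m"
    by (simp add: discrim_def power2_eq_square algebra_simps)
  ultimately show ?thesis
    using discriminant_iff[of "m - 1" \<beta> "- (6 + 3 * m)" "2 * m - 9"] \<open>m > 1\<close>
    by (simp add: add.commute)
qed

theorem mainTheorem3:
  fixes \<eta> \<theta>\<^sub>1 m :: real
  assumes "\<eta> > 0" and "\<theta>\<^sub>1 > 0"
    and "m = 1 + 3 / (2 * \<eta>)"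
  shows
    "(\<forall>\<beta>\<^sub>2 \<theta>\<^sub>2 :: real. compatible \<eta> \<theta>\<^sub>1 (1 / 2) \<beta>\<^sub>2 \<theta>\<^sub>2 \<and> \<beta>\<^sub>2 > 3 \<longrightarrow>
        \<beta>\<^sub>2 = (6 * m + 1 + sqrt (48 * m + 1)) / (2 * (m - 1)) \<and>
        \<theta>\<^sub>2 = \<theta>\<^sub>1 * (\<eta> / (\<beta>\<^sub>2 - 3)\<^sup>2)) \<and>
     (\<forall>\<beta>\<^sub>3 \<theta>\<^sub>3 :: real. compatible \<eta> \<theta>\<^sub>1 (- 1 / 2) \<beta>\<^sub>3 \<theta>\<^sub>3 \<and> \<beta>\<^sub>3 > 2 \<longrightarrow>
        (\<beta>\<^sub>3 = (6 + 3 * m + sqrt (m\<^sup>2 + 80 * m)) / (2 * (m - 1)) \<or>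
         \<beta>\<^sub>3 = (6 + 3 * m - sqrt (m\<^sup>2 + 80 * m)) / (2 * (m - 1))) \<and>
        \<theta>\<^sub>3 = \<theta>\<^sub>1 * \<eta> * (\<beta>\<^sub>3 + 3)\<^sup>2) \<and>
     (\<forall>\<beta>\<^sub>4 \<theta>\<^sub>4 :: real. compatible \<eta> \<theta>\<^sub>1 (- 1) \<beta>\<^sub>4 \<theta>\<^sub>4 \<and> \<beta>\<^sub>4 > 1 \<longrightarrow>
        \<beta>\<^sub>4 = 1 + 5 / 3 * \<eta> \<and>
        \<theta>\<^sub>4 = \<theta>\<^sub>1 * \<eta> * (\<beta>\<^sub>4 + 3 / 2))"
proof (intro conjI allI impI; elim conjE)
  have "m > 1" using assms by simp
  note shape = compatible_imp_shape_equation[OF \<open>\<eta> > 0\<close>, folded \<open>m = 1 + 3 / (2 * \<eta>)\<close>]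
  {
    fix \<beta> \<theta> assume c: "compatible \<eta> \<theta>\<^sub>1 (1 / 2) \<beta> \<theta>" and "\<beta> > 3"
    have "Gamma \<beta> \<noteq> 0" using \<open>\<beta> > 3\<close> Gamma_real_pos[of \<beta>] by linarith
    then have "\<beta> * (\<beta> + 1) = m * (\<beta> - 3)\<^sup>2"
      using shape[OF c] Gamma_add_two_pos[of \<beta>] \<open>\<beta> > 3\<close> by simp
    then show "\<beta> = (6 * m + 1 + sqrt (48 * m + 1)) / (2 * (m - 1))"
      by (rule shape_half[OF \<open>m > 1\<close> \<open>\<beta> > 3\<close>])
    show "\<theta> = \<theta>\<^sub>1 * (\<eta> / (\<beta> - 3)\<^sup>2)"
      using c \<open>\<beta> > 3\<close> by (simp add: compatible_def gg_baseline_def field_simps)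
  next
    fix \<beta> \<theta> assume c: "compatible \<eta> \<theta>\<^sub>1 (- 1 / 2) \<beta> \<theta>" and "\<beta> > 2"
    have p: "(\<beta> + 3) powr - 2 = 1 / (\<beta> + 3)\<^sup>2"
      using \<open>\<beta> > 2\<close> by (simp add: powr_minus_divide)
    have "Gamma \<beta> = (\<beta> - 1) * (\<beta> - 2) * Gamma (\<beta> - 2)"
      using Gamma_add_two_pos[of "\<beta> - 2"] \<open>\<beta> > 2\<close> by (simp add: mult.commute)
    moreover have "Gamma (\<beta> - 2) \<noteq> 0"
      using \<open>\<beta> > 2\<close> Gamma_real_pos[of "\<beta> - 2"] by linarith
    ultimately have "Gamma (\<beta> - 2) / Gamma \<beta> = 1 / ((\<beta> - 1) * (\<beta> - 2))"
      by simp
    then have "1 / ((\<beta> - 1) * (\<beta> - 2)) = m * (1 / (\<beta> + 3)\<^sup>2)"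
      using shape[OF c] p by simp
    then have "(\<beta> + 3)\<^sup>2 = m * ((\<beta> - 1) * (\<beta> - 2))"
      using \<open>\<beta> > 2\<close> by (simp add: frac_eq_eq)
    then show "\<beta> = (6 + 3 * m + sqrt (m\<^sup>2 + 80 * m)) / (2 * (m - 1)) \<or>
        \<beta> = (6 + 3 * m - sqrt (m\<^sup>2 + 80 * m)) / (2 * (m - 1))"
      by (rule shape_minus_half[OF \<open>m > 1\<close>])
    have "\<theta> * (1 / (\<beta> + 3)\<^sup>2) = \<theta>\<^sub>1 * \<eta>"
      using c p by (simp add: compatible_def gg_baseline_def)
    then show "\<theta> = \<theta>\<^sub>1 * \<eta> * (\<beta> + 3)\<^sup>2"
      using \<open>\<beta> > 2\<close> by (simp add: divide_eq_eq)
  next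
    fix \<beta> \<theta> assume c: "compatible \<eta> \<theta>\<^sub>1 (- 1) \<beta> \<theta>" and "\<beta> > 1"
    have p: "(\<beta> + 3 / 2) powr - 1 = 1 / (\<beta> + 3 / 2)"
      using \<open>\<beta> > 1\<close> by (simp add: powr_minus_divide)
    have "Gamma \<beta> = (\<beta> - 1) * Gamma (\<beta> - 1)"
      using Gamma_add_one_pos[of "\<beta> - 1"] \<open>\<beta> > 1\<close> by simp
    moreover have "Gamma (\<beta> - 1) \<noteq> 0"
      using \<open>\<beta> > 1\<close> Gamma_real_pos[of "\<beta> - 1"] by linarith
    ultimately have "Gamma (\<beta> - 1) / Gamma \<beta> = 1 / (\<beta> - 1)"
      by simp
    then have "1 / (\<beta> - 1) = m * (1 / (\<beta> + 3 / 2))"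
      using shape[OF c] p by simp
    then have "\<beta> + 3 / 2 = m * (\<beta> - 1)"
      using \<open>\<beta> > 1\<close> by (simp add: frac_eq_eq)
    then show "\<beta> = 1 + 5 / 3 * \<eta>"
      unfolding \<open>m = 1 + 3 / (2 * \<eta>)\<close> using \<open>\<eta> > 0\<close> by (simp add: field_simps)
    have "\<theta> * (1 / (\<beta> + 3 / 2)) = \<theta>\<^sub>1 * \<eta>"
      using c p \<open>\<beta> > 1\<close> by (simp add: compatible_def gg_baseline_def)
    then show "\<theta> = \<theta>\<^sub>1 * \<eta> * (\<beta> + 3 / 2)"
      using \<open>\<beta> > 1\<close> by (simp add: divide_eq_eq)
  }
qed

end
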